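(* Let $b\in(0,1)$. Let $\kappa(s)$ be the curvature of the ellipse $E=\{(x,y)\in\mathbb{R}^2 : x^2+y^2/b^2=1\}$ in some arc-length parameter $s$. Let $\xi\in\mathbb{R}/\mathbb{Z}$ be the angular variable defined by $$C\frac{d\xi}{ds}=\kappa^{2/3}(s),\qquad C=\int_E\kappa^{2/3}\,ds.$$ Let $\delta$ be the distance of the set of singularities and zeros of the curvature $\kappa(\xi)$ to the real axis. Then $$2\pi\delta=c,\qquad\text{where } c=\frac{\pi K(b^2)}{2K(1-b^2)}.$$
   Context: $K(m)=\int_0^{\pi/2}(1-m\sin^2\theta)^{-1/2}\,d\theta$, for $m\in[0,1)$, is the complete elliptic integral of the first kind. By abuse of notation, $\kappa(\xi)=\kappa(s_0(\xi))$, where $s=s_0(\xi)$ is the inverse of the solution $\xi=\xi_0(s)$ of the differential equation defining $\xi$ with $\xi_0(0)=0$. It is a $1$-periodic real analytic function which does not vanish on the reals, and is extended analytically to complex $\xi$. The number $\delta>0$ is such that $\kappa(\xi)$ is analytic and does not vanish on the open complex strip $\{\xi\in\mathbb{C}:|\operatorname{Im}\xi|<\delta\}$ and has singularities and/or zeros on the boundary of this strip. *)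

theory Defs
  imports "HOL-Complex_Analysis.Complex_Analysis"
begin

definition ellipse :: "real \<Rightarrow> (real \<times> real) set" where
  "ellipse b = {(x, y). x\<^sup>2 + y\<^sup>2 / b\<^sup>2 = 1}"

text \<open>
  The curve \<open>\<gamma>\<close> runs with unit speed around the closed curve \<open>E\<close> of perimeter \<open>L\<close>.
  The starting point and the orientation are arbitrary.
\<close>
definition arc_length_parametrization ::
    "(real \<times> real) set \<Rightarrow> real \<Rightarrow> (real \<Rightarrow> real \<times> real) \<Rightarrow> bool" where
  "arc_length_parametrization E L \<gamma> \<longleftrightarrow>
     L > 0 \<and>
     (\<forall>s. \<gamma> differentiable (at s)) \<and>
     (\<forall>s. (\<lambda>t. vector_derivative \<gamma> (at t)) differentiable (at s)) \<and>
     (\<forall>s. norm (vector_derivative \<gamma> (at s)) = 1) \<and>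
     (\<forall>s. \<gamma> (s + L) = \<gamma> s) \<and>
     bij_betw \<gamma> {0..<L} E"

text \<open>Unsigned curvature; the formula is valid for unit-speed curves only.\<close>
definition curvature :: "(real \<Rightarrow> real \<times> real) \<Rightarrow> real \<Rightarrow> real" where
  "curvature \<gamma> s = norm (vector_derivative (\<lambda>t. vector_derivative \<gamma> (at t)) (at s))"

text \<open>The argument is the parameter \<open>m\<close>, that is, the square of the elliptic modulus.\<close>
definition complete_elliptic_K :: "real \<Rightarrow> real" where
  "complete_elliptic_K m = integral {0..pi/2} (\<lambda>\<theta>. (1 - m * (sin \<theta>)\<^sup>2) powr (-1/2))"

definition strip :: "real \<Rightarrow> complex set" where
  "strip d = {z. \<bar>Im z\<bar> < d}"

text \<open>
  Since a strip is connected and contains the real axis, the extension \<open>f\<close> of \<open>k\<close> is unique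
  on it, so the following notions do not suffer from multivaluedness.
\<close>
definition analytic_extension_on_strip ::
    "(real \<Rightarrow> real) \<Rightarrow> real \<Rightarrow> (complex \<Rightarrow> complex) \<Rightarrow> bool" where
  "analytic_extension_on_strip k d f \<longleftrightarrow>
     d > 0 \<and> f holomorphic_on strip d \<and> (\<forall>x. f (of_real x) = of_real (k x))"

definition local_analytic_extension ::
    "(complex \<Rightarrow> complex) \<Rightarrow> complex set \<Rightarrow> complex \<Rightarrow> (complex \<Rightarrow> complex) \<Rightarrow> bool" where
  "local_analytic_extension f S z g \<longleftrightarrow>
     (\<exists>r>0. g holomorphic_on ball z r \<and> (\<forall>w \<in> ball z r \<inter> S. g w = f w))"

text \<open>
  Singularities and zeros of a real function, as far as they are seen from the strips
  \<open>\<bar>Im z\<bar> < d\<close> to which it extends analytically, boundary included. Points beyond the maximal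
  strip are not recorded; they do not affect the distance to the real axis.
\<close>
definition singularities :: "(real \<Rightarrow> real) \<Rightarrow> complex set" where
  "singularities k = {z. \<exists>d f. analytic_extension_on_strip k d f \<and> \<bar>Im z\<bar> = d \<and>
     \<not> (\<exists>g. local_analytic_extension f (strip d) z g)}"

definition zeros :: "(real \<Rightarrow> real) \<Rightarrow> complex set" where
  "zeros k = {z. \<exists>d f g. analytic_extension_on_strip k d f \<and> \<bar>Im z\<bar> \<le> d \<and>
     local_analytic_extension f (strip d) z g \<and> g z = 0}"

lemma strip_open: "open (strip d)" and strip_connected: "connected (strip d)"
proof -
  have eq: "strip d = {z. Im z < d} \<inter> {z. Im z > -d}"
    by (auto simp: strip_def)
  show "open (strip d)"
    unfolding eq by (intro open_Int open_halfspace_Im_lt open_halfspace_Im_gt)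
  have "convex (strip d)"
    unfolding eq by (intro convex_Int convex_halfspace_Im_lt convex_halfspace_Im_gt)
  then show "connected (strip d)"
    by (rule convex_connected)
qed

lemma analytic_extension_on_strip_unique:
  assumes f: "analytic_extension_on_strip k d f" and g: "analytic_extension_on_strip k e g"
    and z: "\<bar>Im z\<bar> < d" "\<bar>Im z\<bar> < e"
  shows "f z = g z"
proof -
  define m where "m = min d e"
  have m: "m > 0" "strip m \<subseteq> strip d" "strip m \<subseteq> strip e"
    using f g by (auto simp: m_def analytic_extension_on_strip_def strip_def)
  have "(\<lambda>z. f z - g z) holomorphic_on strip m"
    using f g m unfolding analytic_extension_on_strip_def
    by (intro holomorphic_intros) (auto intro: holomorphic_on_subset)
  moreover have "(0::complex) islimpt \<real>"
  proof (subst islimpt_approachable, intro allI impI)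
    fix e :: real assume "e > 0"
    then show "\<exists>x'\<in>\<real>. x' \<noteq> 0 \<and> dist x' (0::complex) < e"
      by (intro bexI[of _ "of_real (e/2)"]) (auto simp del: of_real_divide)
  qed
  moreover have "\<real> \<subseteq> strip m"
    using m by (auto simp: strip_def elim!: Reals_cases)
  moreover have "f x - g x = 0" if "x \<in> \<real>" for x
    using that f g by (auto simp: analytic_extension_on_strip_def elim!: Reals_cases)
  moreover have "z \<in> strip m" "0 \<in> strip m"
    using z m by (auto simp: strip_def m_def)
  ultimately have "f z - g z = 0"
    using analytic_continuation[OF _ strip_open strip_connected] by blast
  then show ?thesis by simp
qed

text \<open>
  The distance of these points to the real axis is the half-width \<open>\<delta>\<close> of the open strip on which
  \<open>k\<close> is analytic without zeros and whose boundary carries a singularity or a zero.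
\<close>
lemma setdist_singularities_zeros_eq:
  assumes f: "analytic_extension_on_strip k \<delta> f" and nz: "\<And>z. z \<in> strip \<delta> \<Longrightarrow> f z \<noteq> 0"
    and z0: "\<bar>Im z0\<bar> = \<delta>" "z0 \<in> singularities k \<union> zeros k"
  shows "setdist (singularities k \<union> zeros k) \<real> = \<delta>"
proof (rule antisym)
  have "setdist (singularities k \<union> zeros k) \<real> \<le> dist z0 (of_real (Re z0))"
    using z0 by (intro setdist_le_dist) auto
  also have "\<dots> = \<delta>"
    using z0 by (simp add: dist_norm cmod_def)
  finally show "setdist (singularities k \<union> zeros k) \<real> \<le> \<delta>" .
next
  have far: "\<bar>Im z\<bar> \<ge> \<delta>" if "z \<in> singularities k \<union> zeros k" for z
  proof (rule ccontr)
    assume less: "\<not> \<bar>Im z\<bar> \<ge> \<delta>"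
    then have zin: "z \<in> strip \<delta>" by (simp add: strip_def)
    then obtain r where r: "r > 0" "ball z r \<subseteq> strip \<delta>"
      using open_contains_ball strip_open by blast
    have hol: "f holomorphic_on ball z r"
      using f r unfolding analytic_extension_on_strip_def by (blast intro: holomorphic_on_subset)
    from that show False
    proof
      assume "z \<in> singularities k"
      then obtain h where h: "analytic_extension_on_strip k \<bar>Im z\<bar> h"
        "\<not> (\<exists>g. local_analytic_extension h (strip \<bar>Im z\<bar>) z g)"
        by (auto simp: singularities_def)
      have "local_analytic_extension h (strip \<bar>Im z\<bar>) z f"
        unfolding local_analytic_extension_def
        using r hol analytic_extension_on_strip_unique[OF f h(1)]
        by (intro exI[of _ r]) (auto simp: strip_def)
      with h show False by blast
    next
      assume "z \<in> zeros k"
      then obtain d h g r' where h: "analytic_extension_on_strip k d h" "\<bar>Im z\<bar> \<le> d" "g z = 0"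
        and r': "r' > 0" "g holomorphic_on ball z r'" "\<And>w. w \<in> ball z r' \<inter> strip d \<Longrightarrow> g w = h w"
        by (auto simp: zeros_def local_analytic_extension_def)
      define D where "D = ball z (min r r')"
      have d: "d > 0" using h by (simp add: analytic_extension_on_strip_def)
      have "f w - g w = 0" if "w \<in> D \<inter> strip d" for w
      proof -
        have "w \<in> ball z r" "w \<in> ball z r'" "\<bar>Im w\<bar> < d"
          using that by (auto simp: D_def strip_def)
        then show ?thesis
          using r r' analytic_extension_on_strip_unique[OF f h(1), of w]
          by (auto simp: strip_def)
      qed
      moreover have "(\<lambda>w. f w - g w) holomorphic_on D"
        using hol r' unfolding D_def
        by (intro holomorphic_intros) (auto intro: holomorphic_on_subset)
      moreover have "\<exists>\<zeta>. \<zeta> \<in> D \<inter> strip d"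
      proof -
        define q where "q = min r r'"
        define y where "y = (if \<bar>Im z\<bar> < d then Im z else Im z - sgn (Im z) * min (q/2) d)"
        have q: "q > 0" using r r' by (simp add: q_def)
        have "\<bar>y\<bar> < d" "\<bar>Im z - y\<bar> < q"
          using q d h(2) by (auto simp: y_def sgn_if min_def abs_if split: if_splits)
        then have "Complex (Re z) y \<in> D \<inter> strip d"
          by (simp add: D_def strip_def q_def dist_norm cmod_def)
        then show ?thesis by blast
      qed
      then obtain \<zeta> where \<zeta>: "\<zeta> \<in> D \<inter> strip d" by blast
      moreover have "\<zeta> islimpt (D \<inter> strip d)"
        using \<zeta> by (intro interior_limit_point) (simp add: D_def strip_open interior_open open_Int)
      ultimately have "f z - g z = 0"
        using analytic_continuation[of "\<lambda>w. f w - g w" D "D \<inter> strip d" \<zeta> z] r r'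
        by (auto simp: D_def)
      with nz[OF zin] h show False by simp
    qed
  qed
  show "\<delta> \<le> setdist (singularities k \<union> zeros k) \<real>"
  proof (rule le_setdistI)
    fix x y :: complex
    assume "x \<in> singularities k \<union> zeros k" "y \<in> \<real>"
    then have "\<delta> \<le> \<bar>Im (x - y)\<bar>" using far by (simp add: complex_is_Real_iff)
    also have "\<dots> \<le> dist x y" unfolding dist_norm by (rule abs_Im_le_cmod)
    finally show "\<delta> \<le> dist x y" .
  qed (use z0 in auto)
qed

end

theory Submission
  imports Defs
begin

text \<open>
  Write the ellipse as \<open>(sin \<phi>, b cos \<phi>)\<close> and put \<open>m = 1 - b\<^sup>2\<close> and
  \<open>w = sqrt (1 - m sin\<^sup>2 \<phi>)\<close>. A unit-speed parametrization has \<open>d\<phi> / ds = \<sigma> / w\<close> with a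
  constant sign \<open>\<sigma>\<close> (\<open>ellipse_angle_function\<close>), and its curvature is \<open>b / w\<^sup>3\<close>
  (\<open>ellipse_curvature\<close>). Hence \<open>\<kappa>\<^bsup>2/3\<^esup> ds\<close> is a constant multiple of \<open>d\<phi> / w\<close>, the
  differential of the elliptic integral of the first kind with parameter \<open>m\<close>. So \<open>\<xi>\<close> is, up to an
  affine change, the argument \<open>u\<close> of the Jacobi elliptic functions. One turn around the ellipse
  increases \<open>\<xi>\<close> by \<open>1\<close> and changes \<open>u\<close> by \<open>4 K(m)\<close> (\<open>angle_turns_once\<close>), so that
  \<open>u = u\<^sub>0 + \<sigma> 4 K(m) \<xi>\<close>. As \<open>w\<close> is \<open>dn u\<close>, the curvature is \<open>b / dn\<^sup>3\<close> as a function of \<open>\<xi>\<close>.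

  The function \<open>dn\<close> extends holomorphically and without zeros to the strip \<open>\<bar>Im u\<bar> < K(1 - m)\<close>, and
  it tends to \<open>0\<close> at the boundary point \<open>K(m) + \<i> K(1 - m)\<close>. There the curvature has a singularity,
  and \<open>\<delta> = K(1 - m) / (4 K(m))\<close> with \<open>1 - m = b\<^sup>2\<close>
  (\<open>setdist_singularities_inverse_dn_cubed\<close>). The extension is written down as an explicit expression
  in real elliptic functions with parameters \<open>m\<close> and \<open>1 - m\<close>, and its Cauchy-Riemann equations are a
  polynomial identity (\<open>dn_complex_field_differentiable\<close>).
\<close>

section \<open>Antiderivatives and bijections of the real line\<close>

text \<open>
  The antiderivative of a continuous function on the whole line that vanishes at \<open>0\<close>. The sign
  is built in because the integral over a reversed interval is \<open>0\<close>.
\<close>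
definition signed_integral :: "(real \<Rightarrow> real) \<Rightarrow> real \<Rightarrow> real" where
  "signed_integral f x = (if 0 \<le> x then integral {0..x} f else - integral {x..0} f)"

lemma signed_integral_0 [simp]: "signed_integral f 0 = 0"
  by (simp add: signed_integral_def)

lemma signed_integral_has_real_derivative:
  assumes "continuous_on UNIV f"
  shows "(signed_integral f has_real_derivative f x) (at x)"
proof -
  define a b where "a = min 0 x - 1" and "b = max 0 x + 1"
  have cont: "continuous_on {u..v} f" for u v
    using assms continuous_on_subset by blast
  have eq: "signed_integral f y = integral {a..y} f - integral {a..0} f" if "y \<in> {a<..<b}" for y
  proof (cases "0 \<le> y")
    case True
    then have "integral {a..0} f + integral {0..y} f = integral {a..y} f"
      by (intro Henstock_Kurzweil_Integration.integral_combine integrable_continuous_interval cont)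
        (auto simp: a_def)
    with True show ?thesis by (simp add: signed_integral_def)
  next
    case False
    then have "integral {a..y} f + integral {y..0} f = integral {a..0} f"
      using that
      by (intro Henstock_Kurzweil_Integration.integral_combine integrable_continuous_interval cont) auto
    with False show ?thesis by (simp add: signed_integral_def)
  qed
  have x: "x \<in> {a<..<b}" by (auto simp: a_def b_def)
  have "((\<lambda>y. integral {a..y} f) has_real_derivative f x) (at x within {a..b})"
    using x by (intro integral_has_real_derivative cont) auto
  then have "((\<lambda>y. integral {a..y} f) has_real_derivative f x) (at x)"
    using x at_within_Icc_at[of a x b] by simp
  then have "((\<lambda>y. integral {a..y} f - integral {a..0} f) has_real_derivative f x) (at x)"
    by (auto intro!: derivative_eq_intros)
  then show ?thesis
    using eq x by (subst has_field_derivative_cong_eventually[where g="\<lambda>y. integral {a..y} f - integral {a..0} f"])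
      (auto intro!: eventually_mono[OF eventually_at_in_open'[of "{a<..<b}" x]])
qed

text \<open>
  The lower bound on the derivative is uniform, so the function grows at least linearly and cannot
  level off at a horizontal asymptote; this is what makes it onto.
\<close>
lemma derivative_ge_1_on_line:
  fixes f f' :: "real \<Rightarrow> real"
  assumes der: "\<And>x. (f has_real_derivative f' x) (at x)" and ge: "\<And>x. f' x \<ge> 1"
  shows strict_mono_if_derivative_ge_1: "strict_mono f" and bij_if_derivative_ge_1: "bij f"
proof -
  have pos: "f' x > 0" for x
    using ge[of x] by simp
  show mono: "strict_mono f"
  proof (rule strict_monoI)
    fix x y :: real assume "x < y"
    then show "f x < f y"
      using der pos by (rule_tac DERIV_pos_imp_increasing) blast+
  qed
  have grow: "f y - f x \<ge> y - x" if "x \<le> y" for x y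
  proof -
    have "f x - x \<le> f y - y"
    proof (rule DERIV_nonneg_imp_nondecreasing[OF that])
      fix t
      have "((\<lambda>x. f x - x) has_real_derivative f' t - 1) (at t)"
        by (intro derivative_intros der)
      then show "\<exists>d. ((\<lambda>x. f x - x) has_real_derivative d) (at t) \<and> 0 \<le> d"
        using ge[of t] by force
    qed
    then show ?thesis by simp
  qed
  have "\<exists>x. f x = y" for y
  proof -
    define r where "r = \<bar>y - f 0\<bar>"
    have "f (-r) \<le> y" "y \<le> f r" "-r \<le> r"
      using grow[of "-r" 0] grow[of 0 r] by (auto simp: r_def)
    moreover have "isCont f x" for x using der DERIV_isCont by blast
    ultimately show ?thesis using IVT[of f "-r" y r] by blast
  qed
  then have "surj f" by (metis surjI)
  then show "bij f"
    using mono by (simp add: bij_def strict_mono_imp_inj_on)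
qed

section \<open>Real Jacobi elliptic functions\<close>

text \<open>
  The incomplete elliptic integral of the first kind; as in the complete integral, \<open>m\<close> is the
  square of the modulus.
\<close>
definition elliptic_F :: "real \<Rightarrow> real \<Rightarrow> real" where
  "elliptic_F m = signed_integral (\<lambda>\<theta>. (1 - m * (sin \<theta>)\<^sup>2) powr (-1/2))"

lemma elliptic_F_0 [simp]: "elliptic_F m 0 = 0"
  by (simp add: elliptic_F_def)

lemma elliptic_F_pi_half: "elliptic_F m (pi/2) = complete_elliptic_K m"
  by (simp add: elliptic_F_def complete_elliptic_K_def signed_integral_def)

locale elliptic_parameter =
  fixes m :: real
  assumes m: "0 \<le> m" "m < 1"
begin

lemma radicand_pos: "0 < 1 - m * (sin \<theta>)\<^sup>2"
proof -
  have "m * (sin \<theta>)\<^sup>2 \<le> m * 1"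
    using m by (intro mult_left_mono) (auto simp: abs_square_le_1)
  then show ?thesis using m by linarith
qed

lemma radicand_le_1: "1 - m * (sin \<theta>)\<^sup>2 \<le> 1"
  using m by simp

lemma F_has_derivative:
  "(elliptic_F m has_real_derivative 1 / sqrt (1 - m * (sin \<theta>)\<^sup>2)) (at \<theta>)"
proof -
  have "continuous_on UNIV (\<lambda>\<theta>. (1 - m * (sin \<theta>)\<^sup>2) powr (-1/2))"
    using radicand_pos by (intro continuous_intros) (auto simp: less_imp_neq[symmetric])
  from signed_integral_has_real_derivative[OF this, of \<theta>] show ?thesis
    using radicand_pos[of \<theta>] by (simp add: elliptic_F_def powr_minus_divide powr_half_sqrt)
qed

lemma F_bij: "bij (elliptic_F m)" and F_strict_mono: "strict_mono (elliptic_F m)"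
  using derivative_ge_1_on_line[OF F_has_derivative] radicand_pos radicand_le_1
  by (auto simp: field_simps)

lemma F_minus: "elliptic_F m (-\<theta>) = - elliptic_F m \<theta>"
proof -
  have "\<forall>x. ((\<lambda>x. elliptic_F m (-x) + elliptic_F m x) has_real_derivative 0) (at x)"
    by (auto intro!: derivative_eq_intros DERIV_chain2[OF F_has_derivative])
  from DERIV_isconst_all[OF this, of \<theta> 0] show ?thesis by simp
qed

text \<open>
  The integrand has period \<open>pi\<close> and is even, so every half turn contributes the integral from
  \<open>-pi/2\<close> to \<open>pi/2\<close>, which is \<open>2 K(m)\<close>.
\<close>
lemma F_add_2pi: "elliptic_F m (\<theta> + 2 * pi) = elliptic_F m \<theta> + 4 * complete_elliptic_K m"
proof -
  have half: "elliptic_F m (\<theta> + pi) = elliptic_F m \<theta> + 2 * complete_elliptic_K m" for \<theta>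
  proof -
    have "\<forall>x. ((\<lambda>x. elliptic_F m (x + pi) - elliptic_F m x) has_real_derivative 0) (at x)"
      by (auto intro!: derivative_eq_intros DERIV_chain2[OF F_has_derivative])
    from DERIV_isconst_all[OF this, of \<theta> "-pi/2"] show ?thesis
      using F_minus[of "pi/2"] by (simp add: elliptic_F_pi_half)
  qed
  show ?thesis using half[of \<theta>] half[of "\<theta> + pi"] by (simp add: add.assoc)
qed

lemma K_pos: "complete_elliptic_K m > 0"
  using strict_monoD[OF F_strict_mono, of 0 "pi/2"] by (simp add: elliptic_F_pi_half)

text \<open>
  The Jacobi amplitude and the three Jacobi functions of a real argument, from which the
  continuation of \<open>dn\<close> to complex arguments is built below.
\<close>
definition am :: "real \<Rightarrow> real" where "am = inv (elliptic_F m)"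
definition sn :: "real \<Rightarrow> real" where "sn u = sin (am u)"
definition cn :: "real \<Rightarrow> real" where "cn u = cos (am u)"
definition dn :: "real \<Rightarrow> real" where "dn u = sqrt (1 - m * (sn u)\<^sup>2)"

lemma am_F [simp]: "am (elliptic_F m \<theta>) = \<theta>" and F_am [simp]: "elliptic_F m (am u) = u"
  unfolding am_def using F_bij by (auto simp: bij_is_inj bij_is_surj surj_f_inv_f)

lemma am_K: "am (complete_elliptic_K m) = pi/2"
  by (metis am_F elliptic_F_pi_half)

lemma dn_pos: "dn u > 0"
  using radicand_pos by (simp add: dn_def sn_def)

lemma cn_sq: "(cn u)\<^sup>2 = 1 - (sn u)\<^sup>2"
  by (simp add: sn_def cn_def cos_squared_eq)

lemma dn_sq: "(dn u)\<^sup>2 = 1 - m * (sn u)\<^sup>2"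
  using radicand_pos by (simp add: dn_def sn_def less_imp_le)

lemma sn_K: "sn (complete_elliptic_K m) = 1" and cn_K: "cn (complete_elliptic_K m) = 0"
  by (simp_all add: sn_def cn_def am_K)

lemma dn_le_1: "dn u \<le> 1"
  using m by (simp add: dn_def)

text \<open>
  On the open interval between \<open>-K(m)\<close> and \<open>K(m)\<close> the amplitude stays within a quarter turn
  of \<open>0\<close>. Applied to the complementary parameter this is what keeps the continuation of \<open>dn\<close>
  free of poles and zeros in its strip.
\<close>
lemma cn_pos:
  assumes "\<bar>u\<bar> < complete_elliptic_K m"
  shows "cn u > 0"
proof -
  have "elliptic_F m (-(pi/2)) < elliptic_F m (am u)" "elliptic_F m (am u) < elliptic_F m (pi/2)"
    using assms by (simp_all add: F_minus elliptic_F_pi_half abs_less_iff del: F_am) (simp_all)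
  then show ?thesis
    unfolding cn_def strict_mono_less[OF F_strict_mono] by (intro cos_gt_zero_pi)
qed

lemma am_has_derivative: "(am has_real_derivative dn u) (at u)"
proof -
  have "(am has_real_derivative inverse (1 / sqrt (1 - m * (sin (am u))\<^sup>2))) (at u)"
  proof (rule has_field_derivative_inverse_strong_x[OF F_has_derivative, where S=UNIV])
    show "1 / sqrt (1 - m * (sin (am u))\<^sup>2) \<noteq> 0"
      using radicand_pos[of "am u"] by simp
    show "continuous_on UNIV (elliptic_F m)"
      using F_has_derivative by (intro DERIV_continuous_on) (auto intro: has_field_derivative_at_within)
  qed auto
  then show ?thesis by (simp add: dn_def sn_def)
qed

lemma sn_has_derivative: "(sn has_real_derivative cn u * dn u) (at u)"
  unfolding sn_def cn_def by (auto intro!: derivative_eq_intros am_has_derivative)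

lemma cn_has_derivative: "(cn has_real_derivative - (sn u * dn u)) (at u)"
  unfolding sn_def cn_def by (auto intro!: derivative_eq_intros am_has_derivative)

lemma dn_has_derivative: "(dn has_real_derivative - (m * sn u * cn u)) (at u)"
proof -
  have "((\<lambda>u. 1 - m * (sn u)\<^sup>2) has_real_derivative - (2 * m * sn u * cn u * dn u)) (at u)"
    by (auto intro!: derivative_eq_intros sn_has_derivative)
  from DERIV_chain2[OF DERIV_real_sqrt this] radicand_pos[of "am u"] show ?thesis
    using dn_pos[of u] unfolding dn_def[abs_def] by (simp add: sn_def field_simps)
qed

lemma isCont_cn: "isCont cn u" and isCont_dn: "isCont dn u"
  using cn_has_derivative dn_has_derivative DERIV_isCont by blast+

end

section \<open>Continuation of dn to a strip\<close>

text \<open>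
  Jacobi's imaginary transformation turns \<open>dn\<close> at an imaginary argument into real elliptic functions
  for the parameter \<open>1 - m\<close>. Those carry the prefix \<open>co\<close>, and their quarter period is \<open>K'\<close>.
\<close>
locale complementary_elliptic_parameters = elliptic_parameter m for m :: real +
  assumes m_pos: "0 < m"
begin

sublocale co: elliptic_parameter "1 - m"
  using m m_pos by unfold_locales auto

abbreviation K where "K \<equiv> complete_elliptic_K m"
abbreviation K' where "K' \<equiv> complete_elliptic_K (1 - m)"

text \<open>
  Numerator and denominator of the classical formula for \<open>dn (x + \<i> y)\<close>, which is obtained by
  combining the addition theorem with the imaginary transformation. Taking it as the definition
  avoids proving either of these: it is enough that the formula agrees with \<open>dn\<close> on the real axis
  and is holomorphic.
\<close>
definition dn_num :: "complex \<Rightarrow> complex" where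
  "dn_num z = of_real (dn (Re z) * co.cn (Im z) * co.dn (Im z))
     - \<i> * of_real (m * sn (Re z) * cn (Re z) * co.sn (Im z))"

definition dn_den :: "complex \<Rightarrow> real" where
  "dn_den z = 1 - (dn (Re z))\<^sup>2 * (co.sn (Im z))\<^sup>2"

definition dn_complex :: "complex \<Rightarrow> complex" where
  "dn_complex z = dn_num z / of_real (dn_den z)"

lemma dn_complex_of_real: "dn_complex (of_real u) = of_real (dn u)"
proof -
  have "co.am 0 = 0" using co.am_F[of 0] by (simp del: co.am_F)
  then show ?thesis
    by (simp add: dn_complex_def dn_num_def dn_den_def co.sn_def co.cn_def co.dn_def)
qed

text \<open>
  Here \<open>co.cn\<close> is positive, so \<open>co.sn\<close> has modulus below \<open>1\<close>, while \<open>dn\<close> is at most \<open>1\<close>.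
\<close>
lemma dn_den_pos:
  assumes "\<bar>Im z\<bar> < K'"
  shows "0 < dn_den z"
proof -
  have "(co.sn (Im z))\<^sup>2 < 1"
    using co.cn_pos[OF assms] co.cn_sq[of "Im z"] by (metis diff_gt_0_iff_gt zero_less_power)
  moreover have "(dn (Re z))\<^sup>2 * (co.sn (Im z))\<^sup>2 \<le> 1 * (co.sn (Im z))\<^sup>2"
    using dn_pos[of "Re z"] dn_le_1[of "Re z"]
    by (intro mult_right_mono) (simp_all add: power_le_one)
  ultimately show ?thesis by (simp add: dn_den_def)
qed

text \<open>
  The imaginary term of the numerator does not enter the real part, which is thus a product of
  positive factors. In particular \<open>dn\<close> has no zeros in the open strip.
\<close>
lemma Re_dn_complex_pos:
  assumes "\<bar>Im z\<bar> < K'"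
  shows "0 < Re (dn_complex z)"
  using dn_den_pos[OF assms] co.cn_pos[OF assms] dn_pos[of "Re z"] co.dn_pos[of "Im z"]
  by (simp add: dn_complex_def dn_num_def)

text \<open>
  The polynomial identity to which the Cauchy-Riemann equations reduce: the right-hand side is
  twice the squared modulus of \<open>dn_num\<close>, and the second factor on the left is \<open>dn_den\<close>.
\<close>
lemma dn_num_norm_identity:
  "((co.dn y)\<^sup>2 + (1 - m) * (co.cn y)\<^sup>2 + m * ((cn x)\<^sup>2 - (sn x)\<^sup>2)) * (1 - (dn x)\<^sup>2 * (co.sn y)\<^sup>2)
     = 2 * ((dn x * co.cn y * co.dn y)\<^sup>2 + (m * sn x * cn x * co.sn y)\<^sup>2)"
  unfolding power_mult_distrib cn_sq dn_sq co.cn_sq co.dn_sq by algebra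

text \<open>
  With \<open>N\<close> the numerator and \<open>Q\<close> the denominator, a function \<open>N / Q\<close> of \<open>x\<close> and \<open>y\<close> satisfies the
  Cauchy-Riemann equations iff \<open>(N\<^sub>y - \<i> N\<^sub>x) Q = N (Q\<^sub>y - \<i> Q\<^sub>x)\<close>. The two
  brackets turn out to be a real factor and a real multiple of the conjugate of \<open>N\<close>, so both sides
  are real and the equation becomes the identity above.
\<close>
lemma dn_complex_field_differentiable:
  assumes "\<bar>Im z\<bar> < K'"
  shows "dn_complex field_differentiable at z"
proof -
  define x y where "x = Re z" and "y = Im z"
  define s c d S C D where "s = sn x" and "c = cn x" and "d = dn x"
    and "S = co.sn y" and "C = co.cn y" and "D = co.dn y"
  note defs = s_def c_def d_def S_def C_def D_def x_def y_def
  define N where "N = dn_num z"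
  define Q :: complex where "Q = of_real (dn_den z)"
  \<comment> \<open>The partial derivatives of numerator and denominator.\<close>
  define Nx Ny Qx Qy :: complex where
    "Nx = - of_real (m * s * c * C * D) - \<i> * of_real (m * d * S * (c\<^sup>2 - s\<^sup>2))"
    and "Ny = - of_real (d * S * (D\<^sup>2 + (1 - m) * C\<^sup>2)) - \<i> * of_real (m * s * c * C * D)"
    and "Qx = of_real (2 * m * s * c * d * S\<^sup>2)" and "Qy = - of_real (2 * d\<^sup>2 * S * C * D)"
  have Q: "Q \<noteq> 0" using dn_den_pos[OF assms] by (simp add: Q_def)
  have Re: "((\<lambda>z. of_real (f (Re z)) :: complex) has_derivative (\<lambda>h. of_real (f' * Re h))) (at z)"
    if "(f has_real_derivative f') (at x)" for f f'
    using that unfolding x_def has_field_derivative_def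
    by (intro has_derivative_of_real has_derivative_compose[of Re Re z _ f])
      (auto intro!: derivative_eq_intros)
  have Im: "((\<lambda>z. of_real (f (Im z)) :: complex) has_derivative (\<lambda>h. of_real (f' * Im h))) (at z)"
    if "(f has_real_derivative f') (at y)" for f f'
    using that unfolding y_def has_field_derivative_def
    by (intro has_derivative_of_real has_derivative_compose[of Im Im z _ f])
      (auto intro!: derivative_eq_intros)
  note ders = Re[OF sn_has_derivative] Re[OF cn_has_derivative] Re[OF dn_has_derivative]
    Im[OF co.sn_has_derivative] Im[OF co.cn_has_derivative] Im[OF co.dn_has_derivative]
  have dN: "(dn_num has_derivative (\<lambda>h. Re h *\<^sub>R Nx + Im h *\<^sub>R Ny)) (at z)"
    unfolding dn_num_def[abs_def] of_real_mult
    by (rule ders derivative_eq_intros refl)+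
      (auto simp: fun_eq_iff Nx_def Ny_def defs scaleR_conv_of_real algebra_simps power2_eq_square)
  have dQ: "((\<lambda>z. of_real (dn_den z)) has_derivative (\<lambda>h. Re h *\<^sub>R Qx + Im h *\<^sub>R Qy)) (at z)"
    unfolding dn_den_def[abs_def] of_real_mult of_real_diff of_real_power
    by (rule ders derivative_eq_intros refl)+
      (auto simp: fun_eq_iff Qx_def Qy_def defs scaleR_conv_of_real algebra_simps power2_eq_square)
  have CR: "Ny * Q - N * Qy = \<i> * (Nx * Q - N * Qx)"
  proof -
    have 1: "Ny - \<i> * Nx = of_real (- d * S * (D\<^sup>2 + (1 - m) * C\<^sup>2 + m * (c\<^sup>2 - s\<^sup>2)))"
      by (simp add: complex_eq_iff Nx_def Ny_def algebra_simps)
    have 2: "Qy - \<i> * Qx = of_real (- 2 * d * S) * cnj N"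
      by (simp add: complex_eq_iff Qx_def Qy_def N_def dn_num_def defs algebra_simps power2_eq_square)
    have 3: "N * cnj N = of_real ((d * C * D)\<^sup>2 + (m * s * c * S)\<^sup>2)"
      unfolding complex_mult_cnj by (simp add: N_def dn_num_def defs)
    have 4: "Q = of_real (1 - d\<^sup>2 * S\<^sup>2)"
      by (simp add: Q_def dn_den_def defs)
    have "(Ny - \<i> * Nx) * Q
        = of_real (- d * S * ((D\<^sup>2 + (1 - m) * C\<^sup>2 + m * (c\<^sup>2 - s\<^sup>2)) * (1 - d\<^sup>2 * S\<^sup>2)))"
      unfolding 1 4 by simp
    also have "\<dots> = of_real (- 2 * d * S) * (N * cnj N)"
      unfolding 3 using dn_num_norm_identity[of y x] by (simp add: s_def c_def d_def S_def C_def D_def)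
    also have "\<dots> = N * (Qy - \<i> * Qx)"
      unfolding 2 by simp
    finally show ?thesis by (simp add: algebra_simps)
  qed
  have "(dn_complex has_derivative (*) ((Nx * Q - N * Qx) / Q\<^sup>2)) (at z)"
    unfolding dn_complex_def[abs_def]
  proof (rule has_derivative_eq_rhs[OF has_derivative_divide'[OF dN dQ]])
    show "of_real (dn_den z) \<noteq> (0::complex)" using Q by (simp add: Q_def)
    show "(\<lambda>h. ((Re h *\<^sub>R Nx + Im h *\<^sub>R Ny) * of_real (dn_den z) - dn_num z * (Re h *\<^sub>R Qx + Im h *\<^sub>R Qy))
        / (of_real (dn_den z) * of_real (dn_den z))) = (*) ((Nx * Q - N * Qx) / Q\<^sup>2)"
      (is "?L = ?R")
    proof
      fix h
      have "(Re h *\<^sub>R Nx + Im h *\<^sub>R Ny) * Q - N * (Re h *\<^sub>R Qx + Im h *\<^sub>R Qy)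
          = of_real (Re h) * (Nx * Q - N * Qx) + of_real (Im h) * (Ny * Q - N * Qy)"
        by (simp add: scaleR_conv_of_real algebra_simps)
      also have "\<dots> = h * (Nx * Q - N * Qx)"
        unfolding CR by (subst (5) complex_eq) (simp add: algebra_simps)
      finally show "?L h = ?R h"
        by (simp add: Q_def[symmetric] N_def[symmetric] power2_eq_square)
    qed
  qed
  then show ?thesis
    unfolding field_differentiable_def has_field_derivative_def by blast
qed

lemma dn_complex_holomorphic: "dn_complex holomorphic_on strip K'"
  unfolding holomorphic_on_def strip_def
  using dn_complex_field_differentiable by (auto intro: field_differentiable_at_within)

lemma dn_K_sq: "(dn K)\<^sup>2 = 1 - m"
  by (simp add: dn_sq sn_K)

text \<open>
  On the vertical line through \<open>K\<close> the formula collapses, because \<open>cn K = 0\<close>, to a multiple of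
  \<open>co.cn / co.dn\<close>, which vanishes at \<open>K'\<close>: the point \<open>K + \<i> K'\<close> is a zero of \<open>dn\<close>.
\<close>
lemma dn_complex_K_tendsto_0:
  "((\<lambda>y. dn_complex (Complex K y)) \<longlongrightarrow> 0) (at_left K')"
proof -
  have eq: "dn_complex (Complex K y) = of_real (dn K * co.cn y / co.dn y)" for y
  proof -
    have "dn_den (Complex K y) = (co.dn y)\<^sup>2"
      by (simp add: dn_den_def dn_K_sq co.dn_sq)
    then show ?thesis
      using co.dn_pos[of y] by (simp add: dn_complex_def dn_num_def cn_K power2_eq_square)
  qed
  have "((\<lambda>y. dn K * co.cn y / co.dn y) \<longlongrightarrow> dn K * co.cn K' / co.dn K') (at_left K')"
    using co.isCont_cn[of K'] co.isCont_dn[of K'] co.dn_pos[of K']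
    by (intro tendsto_intros) (auto simp: isCont_def intro: filterlim_mono[OF _ order_refl at_le])
  from tendsto_of_real[OF this, where 'a=complex] show ?thesis
    unfolding eq by (simp add: co.cn_K)
qed

text \<open>
  Inside the strip \<open>dn\<close> is holomorphic without zeros, hence so is the function \<open>b / dn\<^sup>3\<close>. On the boundary
  \<open>dn\<close> tends to \<open>0\<close> at \<open>K + \<i> K'\<close>, so \<open>b / dn\<^sup>3\<close> is unbounded there and cannot be extended.
  The affine substitution with slope \<open>a\<close> divides the width of the strip by \<open>\<bar>a\<bar>\<close>.
\<close>
lemma setdist_singularities_inverse_dn_cubed:
  fixes a b u0 :: real
  assumes a: "a \<noteq> 0" and b: "b \<noteq> 0"
  defines "k \<equiv> \<lambda>x. b / dn (u0 + a * x) ^ 3"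
  shows "setdist (singularities k \<union> zeros k) \<real> = K' / \<bar>a\<bar>"
proof -
  define \<delta> where "\<delta> = K' / \<bar>a\<bar>"
  define T where "T z = of_real u0 + of_real a * z" for z :: complex
  define f where "f z = of_real b / dn_complex (T z) ^ 3" for z
  have \<delta>: "\<delta> > 0" using a co.K_pos by (simp add: \<delta>_def)
  have T: "T z \<in> strip K' \<longleftrightarrow> z \<in> strip \<delta>" for z
    using a by (simp add: T_def strip_def \<delta>_def field_simps abs_mult)
  have nz: "dn_complex (T z) \<noteq> 0" if "z \<in> strip \<delta>" for z
    using Re_dn_complex_pos[of "T z"] T[of z] that by (auto simp: strip_def)
  have "(\<lambda>z. dn_complex (T z)) holomorphic_on strip \<delta>"
    using T unfolding T_def[abs_def]
    by (intro holomorphic_on_compose_gen[OF _ dn_complex_holomorphic, unfolded o_def] holomorphic_intros) auto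
  then have "f holomorphic_on strip \<delta>"
    unfolding f_def[abs_def] using nz by (intro holomorphic_intros) auto
  moreover have "f (of_real x) = of_real (k x)" for x
    using dn_complex_of_real[of "u0 + a * x"] by (simp add: f_def T_def k_def)
  ultimately have ext: "analytic_extension_on_strip k \<delta> f"
    using \<delta> by (simp add: analytic_extension_on_strip_def)
  \<comment> \<open>The preimage under \<open>T\<close> of the vertical segment that ends in the zero \<open>K + \<i> K'\<close> of \<open>dn\<close>.\<close>
  define Z where "Z y = (Complex K y - of_real u0) / of_real a" for y
  have TZ: "T (Z y) = Complex K y" for y
    using a by (simp add: T_def Z_def)
  have "Im (Z y) = y / a" for y
    by (simp add: Z_def)
  then have Im_Z: "\<bar>Im (Z K')\<bar> = \<delta>"
    using co.K_pos by (simp add: \<delta>_def)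
  have sing: "Z K' \<in> singularities k"
  proof -
    have "\<not> local_analytic_extension f (strip \<delta>) (Z K') g" for g
    proof
      assume "local_analytic_extension f (strip \<delta>) (Z K') g"
      then obtain r where r: "r > 0" "g holomorphic_on ball (Z K') r"
        and gf: "\<And>w. w \<in> ball (Z K') r \<inter> strip \<delta> \<Longrightarrow> g w = f w"
        by (auto simp: local_analytic_extension_def)
      have Z: "(Z \<longlongrightarrow> Z K') (at_left K')"
        unfolding Z_def[abs_def] Complex_eq using a by (intro tendsto_intros) auto
      have "isCont g (Z K')"
        using r holomorphic_on_imp_continuous_on[OF r(2)]
        by (simp add: continuous_on_eq_continuous_at)
      then have "((\<lambda>y. g (Z y) * dn_complex (Complex K y) ^ 3) \<longlongrightarrow> g (Z K') * 0 ^ 3) (at_left K')"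
        by (intro tendsto_intros isCont_tendsto_compose[OF _ Z] dn_complex_K_tendsto_0)
      moreover have "eventually (\<lambda>y. g (Z y) * dn_complex (Complex K y) ^ 3 = of_real b) (at_left K')"
      proof -
        have "eventually (\<lambda>y. Z y \<in> ball (Z K') r) (at_left K')"
          using r(1) Z by (intro topological_tendstoD) auto
        moreover have "eventually (\<lambda>y. y \<in> {-K'<..<K'}) (at_left K')"
          using co.K_pos by (intro eventually_at_left_real) auto
        ultimately show ?thesis
        proof eventually_elim
          case (elim y)
          then have "Z y \<in> strip \<delta>"
            using T[of "Z y"] by (auto simp: TZ strip_def)
          with elim gf[of "Z y"] nz[of "Z y"] show ?case
            by (simp add: f_def TZ)
        qed
      qed
      ultimately have "((\<lambda>_. of_real b) \<longlongrightarrow> g (Z K') * 0 ^ 3) (at_left K')"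
        using tendsto_cong by force
      then have "of_real b = g (Z K') * 0 ^ 3"
        by (intro tendsto_unique[OF _ tendsto_const]) auto
      with b show False by simp
    qed
    with ext Im_Z show ?thesis unfolding singularities_def by blast
  qed
  have "setdist (singularities k \<union> zeros k) \<real> = \<delta>"
    using sing nz b by (intro setdist_singularities_zeros_eq[OF ext _ Im_Z]) (auto simp: f_def)
  then show ?thesis by (simp add: \<delta>_def)
qed

end

section \<open>Unit-speed parametrizations of the ellipse\<close>

lemma arc_length_parametrization_in_curve:
  assumes "arc_length_parametrization E L \<gamma>"
  shows "\<gamma> s \<in> E"
proof -
  have L: "L > 0" and per: "\<And>s. \<gamma> (s + L) = \<gamma> s" and bij: "bij_betw \<gamma> {0..<L} E"
    using assms by (auto simp: arc_length_parametrization_def)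
  interpret periodic_fun_simple \<gamma> L by unfold_locales (rule per)
  have "\<gamma> s = \<gamma> (frac (s / L) * L)"
    using plus_of_int[of "frac (s / L) * L" "\<lfloor>s / L\<rfloor>"] L
    by (simp add: frac_def algebra_simps)
  moreover have "frac (s / L) * L \<in> {0..<L}"
    using L frac_lt_1[of "s / L"] by simp
  ultimately show ?thesis
    using bij by (metis bij_betwE)
qed

text \<open>
  Stretching the second coordinate by \<open>1/b\<close> maps the ellipse to the unit circle, where the angular
  velocity \<open>\<rho>\<close> of the moving point is a continuous function of the parameter; its antiderivative
  is a lift of the angle. The unit-speed condition fixes the square of \<open>\<rho>\<close>, and as \<open>\<rho>\<close> never
  vanishes, its sign \<open>\<sigma>\<close>, the orientation, is constant. The angle is measured from the vertical
  axis so that its sine is the first coordinate; in this way the elliptic modulus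
  is the eccentricity.
\<close>
lemma ellipse_angle_function:
  assumes b: "0 < b" and arc: "arc_length_parametrization (ellipse b) L \<gamma>"
  obtains \<phi> \<sigma> where "\<sigma> = 1 \<or> \<sigma> = -1"
    and "\<And>s. \<gamma> s = (sin (\<phi> s), b * cos (\<phi> s))"
    and "\<And>s. (\<phi> has_real_derivative \<sigma> / sqrt (1 - (1 - b\<^sup>2) * (sin (\<phi> s))\<^sup>2)) (at s)"
proof -
  define v where "v s = vector_derivative \<gamma> (at s)" for s
  define x y where "x s = fst (\<gamma> s)" and "y s = snd (\<gamma> s) / b" for s
  define x' y' where "x' s = fst (v s)" and "y' s = snd (v s) / b" for s
  have der: "(\<gamma> has_vector_derivative v s) (at s)" for s
    using arc unfolding arc_length_parametrization_def v_def
    by (simp add: vector_derivative_works)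
  have dx: "(x has_real_derivative x' s) (at s)" for s
    using bounded_linear.has_vector_derivative[OF bounded_linear_fst der[of s]]
    by (simp add: x_def[abs_def] x'_def has_real_derivative_iff_has_vector_derivative)
  have dy: "(y has_real_derivative y' s) (at s)" for s
    using bounded_linear.has_vector_derivative[OF bounded_linear_snd der[of s]] b
    unfolding y_def[abs_def] y'_def has_real_derivative_iff_has_vector_derivative[symmetric]
    by (intro DERIV_cdivide)
  have circle: "(x s)\<^sup>2 + (y s)\<^sup>2 = 1" for s
    using arc_length_parametrization_in_curve[OF arc, of s] b
    by (auto simp: ellipse_def x_def y_def power_divide)
  have orth: "x s * x' s + y s * y' s = 0" for s
  proof -
    have "((\<lambda>s. (x s)\<^sup>2 + (y s)\<^sup>2) has_real_derivative 2 * (x s * x' s + y s * y' s)) (at s)"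
      by (auto intro!: derivative_eq_intros dx dy)
    moreover have "((\<lambda>s. (x s)\<^sup>2 + (y s)\<^sup>2) has_real_derivative 0) (at s)"
      unfolding circle by simp
    ultimately show ?thesis using DERIV_unique by fastforce
  qed
  have speed: "(x' s)\<^sup>2 + b\<^sup>2 * (y' s)\<^sup>2 = 1" for s
  proof -
    have "norm (v s) = 1"
      using arc by (simp add: arc_length_parametrization_def v_def)
    then show ?thesis
      using b by (simp add: norm_prod_def x'_def y'_def power_divide)
  qed
  define \<rho> where "\<rho> s = y s * x' s - x s * y' s" for s
  have x': "x' s = y s * \<rho> s" and y': "y' s = - x s * \<rho> s" for s
  proof -
    have "y s * \<rho> s = ((x s)\<^sup>2 + (y s)\<^sup>2) * x' s - x s * (x s * x' s + y s * y' s)"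
      by (simp add: \<rho>_def algebra_simps power2_eq_square)
    then show "x' s = y s * \<rho> s" by (simp add: circle orth)
    have "- x s * \<rho> s = ((x s)\<^sup>2 + (y s)\<^sup>2) * y' s - y s * (x s * x' s + y s * y' s)"
      by (simp add: \<rho>_def algebra_simps power2_eq_square)
    then show "y' s = - x s * \<rho> s" by (simp add: circle orth)
  qed
  have \<rho>_sq: "(\<rho> s)\<^sup>2 * (1 - (1 - b\<^sup>2) * (x s)\<^sup>2) = 1" for s
  proof -
    have "(\<rho> s)\<^sup>2 * ((y s)\<^sup>2 + b\<^sup>2 * (x s)\<^sup>2) = 1"
      using speed[of s] unfolding x' y' by (simp add: algebra_simps power2_eq_square)
    moreover have "(y s)\<^sup>2 + b\<^sup>2 * (x s)\<^sup>2 = 1 - (1 - b\<^sup>2) * (x s)\<^sup>2"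
      using circle[of s] by (simp add: algebra_simps)
    ultimately show ?thesis by simp
  qed
  have cont_v: "isCont v s" for s
    using arc unfolding arc_length_parametrization_def v_def[abs_def]
    by (auto intro: differentiable_imp_continuous_within)
  have cont_\<rho>: "isCont \<rho> s" for s
    unfolding \<rho>_def[abs_def] x'_def y'_def
    using DERIV_isCont[OF dx[of s]] DERIV_isCont[OF dy[of s]] cont_v[of s] b
    by (intro continuous_intros) auto
  obtain \<sigma> where \<sigma>: "\<sigma> = 1 \<or> \<sigma> = -1" "\<And>s. \<sigma> * \<rho> s > 0"
  proof (rule ccontr)
    assume "\<not> thesis"
    then have "\<not> (\<forall>s. 1 * \<rho> s > 0)" "\<not> (\<forall>s. -1 * \<rho> s > 0)" using that by blast+
    then obtain s t where "\<rho> s \<le> 0" "\<rho> t \<ge> 0" by (auto simp: not_less)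
    moreover have "connected (range \<rho>)"
      using cont_\<rho> by (intro connected_continuous_image continuous_at_imp_continuous_on) auto
    ultimately have "0 \<in> range \<rho>"
      using connectedD_interval[of "range \<rho>" "\<rho> s" "\<rho> t" 0] by blast
    then obtain s where "\<rho> s = 0" by auto
    then show False using \<rho>_sq[of s] by simp
  qed
  have \<rho>_eq: "\<rho> s = \<sigma> / sqrt (1 - (1 - b\<^sup>2) * (x s)\<^sup>2)" for s
  proof -
    define w where "w = sqrt (1 - (1 - b\<^sup>2) * (x s)\<^sup>2)"
    have "1 - (1 - b\<^sup>2) * (x s)\<^sup>2 > 0"
      using \<rho>_sq[of s] by (metis zero_less_mult_pos zero_less_one zero_less_power2 mult_zero_left power_zero_numeral zero_neq_one)
    then have w: "w > 0" "(\<rho> s * w)\<^sup>2 = 1"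
      using \<rho>_sq[of s] by (auto simp: w_def power_mult_distrib)
    then have "\<rho> s * w = 1 \<or> \<rho> s * w = -1" by (simp add: power2_eq_1_iff)
    moreover have "\<sigma> * (\<rho> s * w) > 0" using \<sigma>(2)[of s] w by (simp flip: mult.assoc)
    ultimately have "\<rho> s * w = \<sigma>" using \<sigma>(1) by auto
    then show ?thesis using w unfolding w_def[symmetric] by (simp add: eq_divide_eq)
  qed
  obtain \<phi>0 where \<phi>0: "x 0 = sin \<phi>0" "y 0 = cos \<phi>0"
    using sincos_total_2pi[of "y 0" "x 0"] circle[of 0] by (metis add.commute)
  define \<phi> where "\<phi> s = \<phi>0 + signed_integral \<rho> s" for s
  have d\<phi>: "(\<phi> has_real_derivative \<rho> s) (at s)" for s
    unfolding \<phi>_def[abs_def] using cont_\<rho>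
    by (auto intro!: derivative_eq_intros signed_integral_has_real_derivative
        simp: continuous_at_imp_continuous_on)
  \<comment> \<open>Both points of the circle rotate with angular velocity \<open>\<rho>\<close>, so their distance is constant.\<close>
  have "(x s - sin (\<phi> s))\<^sup>2 + (y s - cos (\<phi> s))\<^sup>2 = 0" for s
  proof -
    have "\<forall>s. ((\<lambda>s. (x s - sin (\<phi> s))\<^sup>2 + (y s - cos (\<phi> s))\<^sup>2) has_real_derivative 0) (at s)"
      by (auto intro!: derivative_eq_intros dx dy d\<phi> simp: x' y' algebra_simps)
    from DERIV_isconst_all[OF this, of s 0] show ?thesis
      by (simp add: \<phi>_def \<phi>0)
  qed
  then have xy: "x s = sin (\<phi> s)" "y s = cos (\<phi> s)" for s
    by (auto simp: sum_power2_eq_zero_iff)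
  show thesis
  proof (rule that[OF \<sigma>(1)])
    show "\<gamma> s = (sin (\<phi> s), b * cos (\<phi> s))" for s
      using xy[of s] b by (simp add: x_def y_def prod_eq_iff field_simps)
    show "(\<phi> has_real_derivative \<sigma> / sqrt (1 - (1 - b\<^sup>2) * (sin (\<phi> s))\<^sup>2)) (at s)" for s
      using d\<phi>[of s] unfolding \<rho>_eq xy .
  qed
qed

text \<open>
  Two differentiations of the explicit form; every derivative of \<open>\<phi>\<close> contributes \<open>\<sigma> / w\<close>, and the
  sign squares away. In terms of the angle this is the familiar curvature formula of the ellipse.
\<close>
lemma ellipse_curvature:
  assumes b: "0 < b" "b < 1" and \<sigma>: "\<sigma> = 1 \<or> \<sigma> = (-1::real)"
    and \<gamma>: "\<And>s. \<gamma> s = (sin (\<phi> s), b * cos (\<phi> s))"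
    and \<phi>: "\<And>s. (\<phi> has_real_derivative \<sigma> / sqrt (1 - (1 - b\<^sup>2) * (sin (\<phi> s))\<^sup>2)) (at s)"
  shows "curvature \<gamma> s = b / sqrt (1 - (1 - b\<^sup>2) * (sin (\<phi> s))\<^sup>2) ^ 3"
proof -
  interpret elliptic_parameter "1 - b\<^sup>2"
    using b by unfold_locales (auto simp: power_le_one)
  define w where "w \<theta> = sqrt (1 - (1 - b\<^sup>2) * (sin \<theta>)\<^sup>2)" for \<theta>
  have w: "w \<theta> > 0" "(w \<theta>)\<^sup>2 = 1 - (1 - b\<^sup>2) * (sin \<theta>)\<^sup>2" for \<theta>
    using radicand_pos[of \<theta>] by (auto simp: w_def)
  have w': "(w \<theta>)\<^sup>2 = (cos \<theta>)\<^sup>2 + b\<^sup>2 * (sin \<theta>)\<^sup>2" for \<theta>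
    by (simp add: w cos_squared_eq algebra_simps)
  note d\<phi> = \<phi>[folded w_def]
  have \<sigma>2: "\<sigma> * \<sigma> = 1" using \<sigma> by auto
  have dw: "(w has_real_derivative - ((1 - b\<^sup>2) * sin \<theta> * cos \<theta> / w \<theta>)) (at \<theta>)" for \<theta>
  proof -
    have "((\<lambda>\<theta>. 1 - (1 - b\<^sup>2) * (sin \<theta>)\<^sup>2) has_real_derivative - (2 * (1 - b\<^sup>2) * sin \<theta> * cos \<theta>)) (at \<theta>)"
      by (auto intro!: derivative_eq_intros)
    then have "((\<lambda>\<theta>. sqrt (1 - (1 - b\<^sup>2) * (sin \<theta>)\<^sup>2)) has_real_derivative
        inverse (sqrt (1 - (1 - b\<^sup>2) * (sin \<theta>)\<^sup>2)) / 2 * - (2 * (1 - b\<^sup>2) * sin \<theta> * cos \<theta>)) (at \<theta>)"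
      by (rule DERIV_chain2[where f = sqrt, rotated]) (rule DERIV_real_sqrt[OF radicand_pos])
    then have "(w has_real_derivative inverse (w \<theta>) / 2 * - (2 * (1 - b\<^sup>2) * sin \<theta> * cos \<theta>)) (at \<theta>)"
      unfolding w_def .
    then show ?thesis
      by (rule DERIV_cong) (use w(1)[of \<theta>] in \<open>simp add: field_simps\<close>)
  qed
  have v: "vector_derivative \<gamma> (at s) = (\<sigma> * (cos (\<phi> s) / w (\<phi> s)), \<sigma> * (- b * (sin (\<phi> s) / w (\<phi> s))))" for s
  proof (rule vector_derivative_at)
    show "(\<gamma> has_vector_derivative (\<sigma> * (cos (\<phi> s) / w (\<phi> s)), \<sigma> * (- b * (sin (\<phi> s) / w (\<phi> s))))) (at s)"
      unfolding \<gamma>[abs_def]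
      by (rule has_vector_derivative_Pair; unfold has_real_derivative_iff_has_vector_derivative[symmetric];
          auto intro!: derivative_eq_intros d\<phi>)
  qed
  have dcos: "((\<lambda>\<theta>. cos \<theta> / w \<theta>) has_real_derivative - (b\<^sup>2 * sin \<theta> / w \<theta> ^ 3)) (at \<theta>)" for \<theta>
  proof (rule DERIV_cong[OF DERIV_divide[OF DERIV_cos dw]])
    have "- sin \<theta> * w \<theta> - cos \<theta> * - ((1 - b\<^sup>2) * sin \<theta> * cos \<theta> / w \<theta>)
       = - sin \<theta> * ((w \<theta>)\<^sup>2 - (1 - b\<^sup>2) * (cos \<theta>)\<^sup>2) / w \<theta>"
      using w(1)[of \<theta>] by (simp add: field_simps power2_eq_square)
    also have "(w \<theta>)\<^sup>2 - (1 - b\<^sup>2) * (cos \<theta>)\<^sup>2 = b\<^sup>2"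
      by (simp add: w cos_squared_eq algebra_simps)
    finally show "(- sin \<theta> * w \<theta> - cos \<theta> * - ((1 - b\<^sup>2) * sin \<theta> * cos \<theta> / w \<theta>)) / (w \<theta> * w \<theta>)
       = - (b\<^sup>2 * sin \<theta> / w \<theta> ^ 3)"
      by (simp add: power3_eq_cube ac_simps)
  qed (use w(1)[of \<theta>] in simp)
  have dsin: "((\<lambda>\<theta>. sin \<theta> / w \<theta>) has_real_derivative cos \<theta> / w \<theta> ^ 3) (at \<theta>)" for \<theta>
  proof (rule DERIV_cong[OF DERIV_divide[OF DERIV_sin dw]])
    have "cos \<theta> * w \<theta> - sin \<theta> * - ((1 - b\<^sup>2) * sin \<theta> * cos \<theta> / w \<theta>)
       = cos \<theta> * ((w \<theta>)\<^sup>2 + (1 - b\<^sup>2) * (sin \<theta>)\<^sup>2) / w \<theta>"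
      using w(1)[of \<theta>] by (simp add: field_simps power2_eq_square)
    also have "(w \<theta>)\<^sup>2 + (1 - b\<^sup>2) * (sin \<theta>)\<^sup>2 = 1"
      by (simp add: w)
    finally show "(cos \<theta> * w \<theta> - sin \<theta> * - ((1 - b\<^sup>2) * sin \<theta> * cos \<theta> / w \<theta>)) / (w \<theta> * w \<theta>)
       = cos \<theta> / w \<theta> ^ 3"
      by (simp add: power3_eq_cube ac_simps)
  qed (use w(1)[of \<theta>] in simp)
  have a: "vector_derivative (\<lambda>t. vector_derivative \<gamma> (at t)) (at s)
      = (- (b\<^sup>2 * sin (\<phi> s) / w (\<phi> s) ^ 4), - (b * cos (\<phi> s) / w (\<phi> s) ^ 4))"
  proof (rule vector_derivative_at)
    have "((\<lambda>s. \<sigma> * (cos (\<phi> s) / w (\<phi> s))) has_real_derivative - (b\<^sup>2 * sin (\<phi> s) / w (\<phi> s) ^ 4)) (at s)"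
      by (rule DERIV_cong[OF DERIV_cmult[OF DERIV_chain2[OF dcos d\<phi>]]])
        (use \<sigma>2 w(1)[of "\<phi> s"] in \<open>simp add: field_simps eval_nat_numeral\<close>)
    moreover have "((\<lambda>s. \<sigma> * (- b * (sin (\<phi> s) / w (\<phi> s)))) has_real_derivative - (b * cos (\<phi> s) / w (\<phi> s) ^ 4)) (at s)"
      by (rule DERIV_cong[OF DERIV_cmult[OF DERIV_cmult[OF DERIV_chain2[OF dsin d\<phi>]]]])
        (use \<sigma>2 w(1)[of "\<phi> s"] in \<open>simp add: field_simps eval_nat_numeral\<close>)
    ultimately show "((\<lambda>t. vector_derivative \<gamma> (at t)) has_vector_derivative
        (- (b\<^sup>2 * sin (\<phi> s) / w (\<phi> s) ^ 4), - (b * cos (\<phi> s) / w (\<phi> s) ^ 4))) (at s)"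
      unfolding v by (intro has_vector_derivative_Pair) (simp_all add: has_real_derivative_iff_has_vector_derivative)
  qed
  have "(b\<^sup>2 * sin (\<phi> s) / w (\<phi> s) ^ 4)\<^sup>2 + (b * cos (\<phi> s) / w (\<phi> s) ^ 4)\<^sup>2
      = b\<^sup>2 * ((cos (\<phi> s))\<^sup>2 + b\<^sup>2 * (sin (\<phi> s))\<^sup>2) / (w (\<phi> s) ^ 4)\<^sup>2"
    by (simp add: power_divide power_mult_distrib add_divide_distrib algebra_simps eval_nat_numeral)
  also have "\<dots> = (b / w (\<phi> s) ^ 3)\<^sup>2"
    unfolding w'[symmetric] using w(1)[of "\<phi> s"] by (simp add: field_simps eval_nat_numeral)
  finally have sum: "(b\<^sup>2 * sin (\<phi> s) / w (\<phi> s) ^ 4)\<^sup>2 + (b * cos (\<phi> s) / w (\<phi> s) ^ 4)\<^sup>2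
      = (b / w (\<phi> s) ^ 3)\<^sup>2" .
  have "norm (- p, - q) = sqrt (p\<^sup>2 + q\<^sup>2)" for p q :: real
    by (simp add: norm_prod_def)
  then have "curvature \<gamma> s = sqrt ((b / w (\<phi> s) ^ 3)\<^sup>2)"
    unfolding curvature_def a by (simp only: sum)
  then show ?thesis
    using w(1)[of "\<phi> s"] b by (simp add: w_def[symmetric])
qed

text \<open>
  After one period the angle has changed by a multiple of \<open>2 pi\<close>, nonzero by monotonicity. A larger
  multiple than one would bring the curve back to its starting point before the end of the period,
  against injectivity.
\<close>
lemma angle_turns_once:
  assumes b: "0 < b" "b < 1" and L: "0 < L" "\<gamma> L = \<gamma> 0" and inj: "inj_on \<gamma> {0..<L}"
    and \<sigma>: "\<sigma> = 1 \<or> \<sigma> = (-1::real)"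
    and \<gamma>: "\<And>s. \<gamma> s = (sin (\<phi> s), b * cos (\<phi> s))"
    and \<phi>: "\<And>s. (\<phi> has_real_derivative \<sigma> / sqrt (1 - (1 - b\<^sup>2) * (sin (\<phi> s))\<^sup>2)) (at s)"
  shows "\<phi> L = \<phi> 0 + \<sigma> * (2 * pi)"
proof -
  interpret elliptic_parameter "1 - b\<^sup>2"
    using b by unfold_locales (auto simp: power_le_one)
  \<comment> \<open>Reversing the orientation if necessary makes the angle increase.\<close>
  define \<psi> where "\<psi> s = \<sigma> * \<phi> s" for s
  have \<sigma>2: "\<sigma> * \<sigma> = 1" using \<sigma> by auto
  have d\<psi>: "(\<psi> has_real_derivative 1 / sqrt (1 - (1 - b\<^sup>2) * (sin (\<phi> s))\<^sup>2)) (at s)" for s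
    unfolding \<psi>_def[abs_def] using DERIV_cmult[OF \<phi>, of \<sigma> s] \<sigma>2 by simp
  have mono: "strict_mono \<psi>"
    using radicand_pos radicand_le_1 by (intro strict_mono_if_derivative_ge_1[OF d\<psi>]) (simp add: field_simps)
  have same: "\<gamma> s = \<gamma> 0" if "\<psi> s = \<psi> 0 + 2 * pi" for s
  proof -
    have "\<phi> s = \<phi> 0 + 2 * pi \<or> \<phi> 0 = \<phi> s + 2 * pi"
      using that \<sigma> by (auto simp: \<psi>_def)
    then show ?thesis unfolding \<gamma> by auto
  qed
  have "sin (\<phi> L) = sin (\<phi> 0) \<and> cos (\<phi> L) = cos (\<phi> 0)"
    using L(2) b unfolding \<gamma> by auto
  then obtain n :: int where n: "\<phi> L = \<phi> 0 + 2 * pi * n"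
    unfolding sin_cos_eq_iff by blast
  have "\<exists>k :: int. \<psi> L = \<psi> 0 + 2 * pi * k"
    using \<sigma> n by (auto simp: \<psi>_def intro: exI[of _ n] exI[of _ "-n"])
  then obtain k :: int where k: "\<psi> L = \<psi> 0 + 2 * pi * k" by blast
  have "0 < 2 * pi * k"
    using strict_monoD[OF mono L(1)] k by simp
  then have "k \<ge> 1" by (simp add: zero_less_mult_iff)
  then have ge: "\<psi> 0 + 2 * pi \<le> \<psi> L" using k by simp
  have "isCont \<psi> s" for s using d\<psi> DERIV_isCont by blast
  then obtain s where s: "0 \<le> s" "s \<le> L" "\<psi> s = \<psi> 0 + 2 * pi"
    using IVT[of \<psi> 0 "\<psi> 0 + 2 * pi" L] ge L(1) by auto
  have "s = L"
  proof (rule ccontr)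
    assume "s \<noteq> L"
    with s L(1) have "s \<in> {0..<L}" "0 \<in> {0..<L}" by auto
    then have "s = 0" using inj same[OF s(3)] by (auto dest: inj_onD)
    with s(3) show False by simp
  qed
  with s(3) show ?thesis using \<sigma> by (auto simp: \<psi>_def)
qed

section \<open>The distance of singularities and zeros of the curvature to the real axis\<close>

theorem proposition4:
  fixes b L C \<delta> c :: real
    and \<gamma> :: "real \<Rightarrow> real \<times> real"
    and \<kappa> \<xi>\<^sub>0 :: "real \<Rightarrow> real"
  assumes "0 < b" and "b < 1"
    and "arc_length_parametrization (ellipse b) L \<gamma>"
    and "\<kappa> = curvature \<gamma>"
    and "C = integral {0..L} (\<lambda>s. \<kappa> s powr (2/3))"
    and "\<xi>\<^sub>0 0 = 0"
    and "\<And>s. \<xi>\<^sub>0 differentiable (at s)"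
    and "\<And>s. C * deriv \<xi>\<^sub>0 s = \<kappa> s powr (2/3)"
    and "\<delta> = setdist (singularities (\<lambda>\<xi>. \<kappa> (inv \<xi>\<^sub>0 \<xi>)) \<union> zeros (\<lambda>\<xi>. \<kappa> (inv \<xi>\<^sub>0 \<xi>))) \<real>"
    and "c = pi * complete_elliptic_K (b\<^sup>2) / (2 * complete_elliptic_K (1 - b\<^sup>2))"
  shows "2 * pi * \<delta> = c"
proof -
  note b = assms(1,2) and arc = assms(3) and \<kappa> = assms(4) and C = assms(5)
  define m where "m = 1 - b\<^sup>2"
  interpret complementary_elliptic_parameters m
    using b by unfold_locales (auto simp: m_def power_le_one power_less_one_iff)
  have L: "L > 0" "\<gamma> L = \<gamma> 0" "inj_on \<gamma> {0..<L}"
    using arc unfolding arc_length_parametrization_def bij_betw_def by (auto dest: spec[of _ 0])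
  obtain \<phi> \<sigma> where \<sigma>: "\<sigma> = 1 \<or> \<sigma> = -1" and \<gamma>: "\<And>s. \<gamma> s = (sin (\<phi> s), b * cos (\<phi> s))"
    and \<phi>: "\<And>s. (\<phi> has_real_derivative \<sigma> / sqrt (1 - m * (sin (\<phi> s))\<^sup>2)) (at s)"
    using ellipse_angle_function[OF b(1) arc] unfolding m_def by metis
  define w where "w s = sqrt (1 - m * (sin (\<phi> s))\<^sup>2)" for s
  have w: "0 < w s" "w s \<le> 1" for s
    using radicand_pos radicand_le_1 by (auto simp: w_def)
  have \<kappa>_eq: "\<kappa> s = b / w s ^ 3" for s
    unfolding \<kappa> w_def m_def by (rule ellipse_curvature[OF b \<sigma> \<gamma> \<phi>[unfolded m_def]])
  define \<beta> where "\<beta> = b powr (2/3)"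
  have \<beta>: "\<beta> > 0" using b by (simp add: \<beta>_def)
  have \<kappa>_powr: "\<kappa> s powr (2/3) = \<beta> / (w s)\<^sup>2" for s
  proof -
    have "(w s ^ 3) powr (2/3) = (w s)\<^sup>2"
      using powr_powr[of "w s" 3 "2/3"] w(1)[of s] by simp
    then show ?thesis
      using w(1)[of s] b by (simp add: \<kappa>_eq \<beta>_def powr_divide)
  qed
  have "C \<noteq> 0"
    using assms(8)[of 0] \<kappa>_powr[of 0] \<beta> w(1)[of 0] by auto
  have d\<xi>: "((\<lambda>s. C * \<xi>\<^sub>0 s) has_real_derivative \<beta> / (w s)\<^sup>2) (at s)" for s
  proof -
    have "(\<xi>\<^sub>0 has_real_derivative deriv \<xi>\<^sub>0 s) (at s)"
      using assms(7)[of s] by (simp add: DERIV_deriv_iff_real_differentiable)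
    from DERIV_cmult[OF this, of C] show ?thesis
      by (simp add: assms(8) \<kappa>_powr)
  qed
  \<comment> \<open>The normalization of \<open>C\<close> makes \<open>\<xi>\<^sub>0\<close> grow by exactly \<open>1\<close> over a full period.\<close>
  have "((\<lambda>s. \<kappa> s powr (2/3)) has_integral (C * \<xi>\<^sub>0 L - C * \<xi>\<^sub>0 0)) {0..L}"
    using L(1) d\<xi> unfolding \<kappa>_powr
    by (intro fundamental_theorem_of_calculus)
      (auto simp flip: has_real_derivative_iff_has_vector_derivative intro: has_field_derivative_at_within)
  from integral_unique[OF this, folded C] have "C = C * \<xi>\<^sub>0 L"
    by (simp add: assms(6))
  with \<open>C \<noteq> 0\<close> have \<xi>L: "\<xi>\<^sub>0 L = 1" by simp
  \<comment> \<open>Both \<open>d\<phi> / ds\<close> and the integrand of \<open>F\<close> contribute a factor \<open>1 / w\<close>, and their product is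
      proportional to \<open>\<kappa>\<^bsup>2/3\<^esup>\<close>: the elliptic integral is an affine function of \<open>\<xi>\<^sub>0\<close>.\<close>
  have F: "elliptic_F m (\<phi> s) = elliptic_F m (\<phi> 0) + \<sigma> * (C / \<beta>) * \<xi>\<^sub>0 s" for s
  proof -
    have "\<forall>s. ((\<lambda>s. elliptic_F m (\<phi> s) - \<sigma> / \<beta> * (C * \<xi>\<^sub>0 s)) has_real_derivative 0) (at s)"
    proof
      fix s
      have "((\<lambda>s. elliptic_F m (\<phi> s)) has_real_derivative 1 / w s * (\<sigma> / w s)) (at s)"
        using DERIV_chain2[OF F_has_derivative \<phi>] by (simp add: w_def)
      from DERIV_diff[OF this DERIV_cmult[OF d\<xi>, of "\<sigma> / \<beta>"]]
      show "((\<lambda>s. elliptic_F m (\<phi> s) - \<sigma> / \<beta> * (C * \<xi>\<^sub>0 s)) has_real_derivative 0) (at s)"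
        using \<beta> by (simp add: power2_eq_square)
    qed
    from DERIV_isconst_all[OF this, of s 0] assms(6) show ?thesis by (simp add: algebra_simps)
  qed
  have "\<phi> L = \<phi> 0 + \<sigma> * (2 * pi)"
    by (rule angle_turns_once[OF b L \<sigma> \<gamma> \<phi>[unfolded m_def]])
  then have C_eq: "C / \<beta> = 4 * K"
    using \<sigma> F[of L] F_add_2pi[of "\<phi> 0"] F_add_2pi[of "\<phi> 0 - 2 * pi"] by (auto simp: \<xi>L)
  have "bij (\<lambda>s. C / \<beta> * \<xi>\<^sub>0 s)"
  proof (rule bij_if_derivative_ge_1)
    show "((\<lambda>s. C / \<beta> * \<xi>\<^sub>0 s) has_real_derivative 1 / (w s)\<^sup>2) (at s)" for s
      using DERIV_cmult[OF d\<xi>[of s], of "1 / \<beta>"] \<beta> by simp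
    show "1 \<le> 1 / (w s)\<^sup>2" for s
      using w[of s] by (simp add: power_le_one)
  qed
  then have "surj (\<lambda>s. C / \<beta> * \<xi>\<^sub>0 s)"
    by (rule bij_is_surj)
  moreover have "C / \<beta> \<noteq> 0"
    using \<open>C \<noteq> 0\<close> \<beta> by simp
  ultimately have "surj \<xi>\<^sub>0"
    unfolding surj_def by (metis mult_left_cancel)
  have \<kappa>_\<xi>: "\<kappa> (inv \<xi>\<^sub>0 \<xi>) = b / dn (elliptic_F m (\<phi> 0) + \<sigma> * (4 * K) * \<xi>) ^ 3" for \<xi>
  proof -
    have "elliptic_F m (\<phi> (inv \<xi>\<^sub>0 \<xi>)) = elliptic_F m (\<phi> 0) + \<sigma> * (4 * K) * \<xi>"
      using F[of "inv \<xi>\<^sub>0 \<xi>"] \<open>surj \<xi>\<^sub>0\<close> by (simp add: C_eq surj_f_inv_f)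
    then have "\<phi> (inv \<xi>\<^sub>0 \<xi>) = am (elliptic_F m (\<phi> 0) + \<sigma> * (4 * K) * \<xi>)"
      by (metis am_F)
    then show ?thesis by (simp add: \<kappa>_eq w_def dn_def sn_def)
  qed
  have "\<delta> = K' / \<bar>\<sigma> * (4 * K)\<bar>"
    unfolding assms(9) \<kappa>_\<xi> using \<sigma> K_pos b
    by (intro setdist_singularities_inverse_dn_cubed) auto
  also have "\<bar>\<sigma> * (4 * K)\<bar> = 4 * K"
    using \<sigma> K_pos by auto
  finally show ?thesis
    unfolding assms(10) using K_pos by (simp add: m_def)
qed

end
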